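(* (i) Let $G$ be a locally finite group, $\phi:G\to G$ an injective group endomorphism and $F$ a finite normal subgroup of $G$. Then $$H_{alg}(\phi,F)=\log\left|\frac{T(\phi,F)}{\phi(T(\phi,F))}\right|.$$ (ii) Consequently, for every torsion abelian group $G$ and every injective endomorphism $\phi:G\to G$, $$h_{alg}(\phi)=\sup\left\{\log\left|\frac{T(\phi,F)}{\phi(T(\phi,F))}\right| : F\in\mathcal F(G)\right\}.$$
   Context: Groups here are discrete. A group is locally finite if each of its finitely generated subgroups is finite. $\mathcal F(G)$ denotes the family of all finite subgroups of $G$. For $F\in\mathcal F(G)$ and a positive integer $n$, the $n$-th $\phi$-trajectory of $F$ is the product set $T_n(\phi,F)=F\cdot\phi(F)\cdot\ldots\cdot\phi^{n-1}(F)$, and the $\phi$-trajectory of $F$ is $T(\phi,F)=\bigcup_{n=1}^\infty T_n(\phi,F)$. (When $F$ is normal in $G$, these are subgroups of $G$, and $\phi(T(\phi,F))\subseteq T(\phi,F)$.) The algebraic entropy of $\phi$ with respect to $F$ is the limit (known to exist) $H_{alg}(\phi,F)=\lim_{n\to\infty}\frac{\log|T_n(\phi,F)|}{n}$, and the algebraic entropy of $\phi$ is $h_{alg}(\phi)=\sup\{H_{alg}(\phi,F):F\in\mathcal F(G)\}$. For a subgroup $B$ of a group $A$, $|A/B|$ denotes the index $[A:B]$ (the number of cosets; $B$ is not required to be normal). *)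

theory Defs
  imports "HOL-Algebra.Algebra" "HOL-Analysis.Analysis"
begin

definition locally_finite_group :: "('a, 'b) monoid_scheme \<Rightarrow> bool" where
  "locally_finite_group G \<longleftrightarrow>
     group G \<and> (\<forall>A. A \<subseteq> carrier G \<longrightarrow> finite A \<longrightarrow> finite (generate G A))"

definition torsion_group :: "('a, 'b) monoid_scheme \<Rightarrow> bool" where
  "torsion_group G \<longleftrightarrow>
     group G \<and> (\<forall>x\<in>carrier G. \<exists>n::nat. n > 0 \<and> x [^]\<^bsub>G\<^esub> n = \<one>\<^bsub>G\<^esub>)"

definition finite_subgroups :: "('a, 'b) monoid_scheme \<Rightarrow> 'a set set" where
  "finite_subgroups G = {F. subgroup F G \<and> finite F}"

(* trajectory_n G \<phi> F n = F \<cdot> \<phi>(F) \<cdot> ... \<cdot> \<phi>^(n-1)(F), with the empty product for n = 0,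
   so that trajectory_n G \<phi> F 1 = F whenever F is a subset of the carrier. *)
primrec trajectory_n ::
  "('a, 'b) monoid_scheme \<Rightarrow> ('a \<Rightarrow> 'a) \<Rightarrow> 'a set \<Rightarrow> nat \<Rightarrow> 'a set" where
  "trajectory_n G \<phi> F 0 = {\<one>\<^bsub>G\<^esub>}"
| "trajectory_n G \<phi> F (Suc n) = trajectory_n G \<phi> F n <#>\<^bsub>G\<^esub> ((\<phi> ^^ n) ` F)"

definition trajectory ::
  "('a, 'b) monoid_scheme \<Rightarrow> ('a \<Rightarrow> 'a) \<Rightarrow> 'a set \<Rightarrow> 'a set" where
  "trajectory G \<phi> F = (\<Union>n\<in>{1..}. trajectory_n G \<phi> F n)"

(* For an endomorphism \<phi> and a finite subgroup F the sequence is nonnegative and its numerators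
   are subadditive in n, so the limit exists and is a real number. *)
definition H_alg ::
  "('a, 'b) monoid_scheme \<Rightarrow> ('a \<Rightarrow> 'a) \<Rightarrow> 'a set \<Rightarrow> real" where
  "H_alg G \<phi> F = lim (\<lambda>n. ln (real (card (trajectory_n G \<phi> F n))) / real n)"

definition h_alg :: "('a, 'b) monoid_scheme \<Rightarrow> ('a \<Rightarrow> 'a) \<Rightarrow> ereal" where
  "h_alg G \<phi> = (SUP F\<in>finite_subgroups G. ereal (H_alg G \<phi> F))"

(* The logarithm of the index [A : B] for subgroups B \<subseteq> A of G. Since card of an infinite set
   is 0, an infinite index has to be sent to \<infinity> explicitly. *)
definition log_index ::
  "('a, 'b) monoid_scheme \<Rightarrow> 'a set \<Rightarrow> 'a set \<Rightarrow> ereal" where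
  "log_index G A B =
     (let C = rcosets\<^bsub>G\<lparr>carrier := A\<rparr>\<^esub> B
      in if finite C then ereal (ln (real (card C))) else \<infinity>)"

end

theory Submission
  imports Defs
begin

text \<open>
  Write \<open>T\<^sub>n\<close> for the \<open>n\<close>-th trajectory of \<open>F\<close> and \<open>T\<close> for their union.  Since \<open>T\<^sub>n\<^sub>+\<^sub>1 = F \<phi>(T\<^sub>n)\<close>
  and \<open>F\<close> is normal, every \<open>T\<^sub>n\<close> is a finite subgroup, although \<open>\<phi>(F)\<close> may fail to be normal;
  likewise \<open>T = F \<phi>(T)\<close> is a subgroup.  Hence the cosets of \<open>\<phi>(T\<^sub>n)\<close> in \<open>T\<^sub>n\<^sub>+\<^sub>1\<close>, and those of
  \<open>\<phi>(T)\<close> in \<open>T\<close>, all have representatives in the one finite set \<open>F\<close>.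

  Two elements \<open>f, g \<in> F\<close> represent the same coset of \<open>\<phi>(T\<^sub>n)\<close> iff \<open>f g\<^sup>-\<^sup>1 \<in> F \<inter> \<phi>(T\<^sub>n)\<close>.  The
  sets \<open>F \<inter> \<phi>(T\<^sub>n)\<close> increase inside a finite set, so from some \<open>n\<close> on they equal
  \<open>F \<inter> \<phi>(T)\<close>, and from there on \<open>[T\<^sub>n\<^sub>+\<^sub>1 : \<phi>(T\<^sub>n)] = [T : \<phi>(T)]\<close>.  Because \<open>\<phi>\<close> is injective,
  Lagrange's theorem turns this into \<open>|T\<^sub>n\<^sub>+\<^sub>1| = [T : \<phi>(T)] |T\<^sub>n|\<close>: the order of \<open>T\<^sub>n\<close> is
  eventually geometric and its exponential growth rate is the logarithm of the common ratio.

  In an abelian group every subgroup is normal, so the formula for \<open>h_alg\<close> is the supremum of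
  these equalities over all finite subgroups.
\<close>

section \<open>Cosets in a product of subgroups\<close>

text \<open>
  The factor from \<open>H\<close> can be absorbed into the coset.  The product \<open>H F\<close> has to be allowed to
  be infinite, because this is applied to whole trajectories as well as to their finite stages.
\<close>

lemma (in group) rcosets_set_mult_eq_image:
  assumes "subgroup H G" "F \<subseteq> carrier G"
  shows "rcosets\<^bsub>G\<lparr>carrier := H <#> F\<rparr>\<^esub> H = (\<lambda>f. H #> f) ` F"
proof -
  have absorb: "H #> (h \<otimes> f) = H #> f" if "h \<in> H" "f \<in> F" for h f
    using that assms coset_mult_assoc[of H h f] coset_join2[of h H]
    by (metis subgroup.mem_carrier subgroup.subset subsetD)
  have member: "f \<in> H <#> F" if "f \<in> F" for f
  proof -
    have "f = \<one> \<otimes> f" using that assms(2) by auto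
    then show ?thesis
      using that subgroup.one_closed[OF assms(1)] unfolding set_mult_def by blast
  qed
  have "(\<lambda>x. H #> x) ` (H <#> F) = (\<lambda>f. H #> f) ` F"
  proof
    show "(\<lambda>x. H #> x) ` (H <#> F) \<subseteq> (\<lambda>f. H #> f) ` F"
      using absorb unfolding set_mult_def by blast
    show "(\<lambda>f. H #> f) ` F \<subseteq> (\<lambda>x. H #> x) ` (H <#> F)"
      using member by blast
  qed
  moreover have "rcosets\<^bsub>G\<lparr>carrier := H <#> F\<rparr>\<^esub> H = (\<lambda>x. H #> x) ` (H <#> F)"
    unfolding RCOSETS_def r_coset_def by auto
  ultimately show ?thesis by simp
qed

lemma card_image_eq_if_same_fibres:
  assumes "\<And>x y. x \<in> A \<Longrightarrow> y \<in> A \<Longrightarrow> f x = f y \<longleftrightarrow> g x = g y"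
  shows "card (f ` A) = card (g ` A)"
proof -
  have "g (inv_into A f (f x)) = g x" if "x \<in> A" for x
    using assms that by (metis f_inv_into_f image_eqI inv_into_into)
  then have "(\<lambda>y. g (inv_into A f y)) ` f ` A = g ` A"
    by (force simp: image_iff)
  moreover have "inj_on (\<lambda>y. g (inv_into A f y)) (f ` A)"
    using assms by (intro inj_onI) (metis f_inv_into_f inv_into_into)
  ultimately show ?thesis using card_image by metis
qed

text \<open>
  Elements \<open>f, g \<in> F\<close> lie in the same coset of \<open>H\<close> iff \<open>f g\<^sup>-\<^sup>1 \<in> F \<inter> H\<close>, so the count sees no
  more of \<open>H\<close> than this intersection.  It lets an infinite \<open>\<phi>(T)\<close> be replaced by a finite stage.
\<close>

lemma (in group) card_rcosets_eq_if_Int_eq: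
  assumes "subgroup F G" "subgroup H G" "subgroup K G" "F \<inter> H = F \<inter> K"
  shows "card ((\<lambda>f. H #> f) ` F) = card ((\<lambda>f. K #> f) ` F)"
proof -
  have carr: "f \<in> carrier G" if "f \<in> F" for f
    using subgroup.mem_carrier[OF assms(1) that] .
  have coset_eq_iff: "L #> f = L #> g \<longleftrightarrow> f \<otimes> inv g \<in> F \<inter> L"
    if "subgroup L G" "f \<in> F" "g \<in> F" for L f g
  proof -
    have "f \<otimes> inv g \<in> F"
      using assms(1) that by (simp add: subgroup.m_closed subgroup.m_inv_closed)
    moreover have "L #> f = L #> g \<longleftrightarrow> f \<in> L #> g"
      using repr_independence[of f L g] repr_independenceD[of L f g] that carr by metis
    ultimately show ?thesis
      using subgroup.rcos_module[OF that(1) is_group] that carr by auto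
  qed
  have "H #> f = H #> g \<longleftrightarrow> K #> f = K #> g" if "f \<in> F" "g \<in> F" for f g
    using coset_eq_iff[OF assms(2) that] coset_eq_iff[OF assms(3) that] assms(4) by metis
  then show ?thesis by (rule card_image_eq_if_same_fibres)
qed

section \<open>Trajectories of a normal subgroup\<close>

locale normal_trajectory = group G for G (structure) +
  fixes \<phi> F
  assumes hom: "\<phi> \<in> hom G G"
    and inj: "inj_on \<phi> (carrier G)"
    and fin: "finite F"
    and normal: "F \<lhd> G"
begin

abbreviation T where "T n \<equiv> trajectory_n G \<phi> F n"
abbreviation T_union where "T_union \<equiv> trajectory G \<phi> F"

sublocale endo: group_hom G G \<phi>
  by unfold_locales (rule hom)

lemma F_subgroup: "subgroup F G"
  using normal by (rule normal_imp_subgroup)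

lemma F_subset: "F \<subseteq> carrier G"
  using F_subgroup by (rule subgroup.subset)

lemma funpow_image_subset: "(\<phi> ^^ n) ` F \<subseteq> carrier G"
proof (induction n)
  case 0
  show ?case using F_subset by simp
next
  case (Suc n)
  then show ?case using endo.hom_closed by auto
qed

lemma T_subset: "T n \<subseteq> carrier G"
proof (induction n)
  case 0
  show ?case by simp
next
  case (Suc n)
  show ?case unfolding trajectory_n.simps by (rule set_mult_closed[OF Suc funpow_image_subset])
qed

text \<open>
  Only \<open>F\<close> itself is known to be normal, not its images, so normality helps only with products
  that have \<open>F\<close> as a factor.  Splitting off \<open>F\<close> on the left instead of \<open>\<phi>\<^sup>n(F)\<close> on the right
  puts the trajectory into this form.
\<close>

lemma T_Suc_left: "T (Suc n) = F <#> \<phi> ` T n"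
proof (induction n)
  case 0
  have "F <#> {\<one>} = F" "{\<one>} <#> F = F"
    using F_subset unfolding set_mult_def by force+
  then show ?case by simp
next
  case (Suc n)
  have "T (Suc (Suc n)) = (F <#> \<phi> ` T n) <#> \<phi> ` (\<phi> ^^ n) ` F"
    using Suc by (simp add: image_comp)
  also have "\<dots> = F <#> (\<phi> ` T n <#> \<phi> ` (\<phi> ^^ n) ` F)"
    using T_subset[of n] funpow_image_subset[of n] F_subset
    by (intro set_mult_assoc) auto
  also have "\<phi> ` T n <#> \<phi> ` (\<phi> ^^ n) ` F = \<phi> ` T (Suc n)"
    using T_subset[of n] funpow_image_subset[of n]
    by (simp add: set_mult_hom[OF hom])
  finally show ?case .
qed

lemma T_subgroup: "subgroup (T n) G"
proof (induction n)
  case 0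
  show ?case by (simp add: triv_subgroup)
next
  case (Suc n)
  then show ?case
    unfolding T_Suc_left
    by (rule mult_norm_subgroup[OF normal endo.subgroup_img_is_subgroup])
qed

lemma T_finite: "finite (T n)"
  using fin by (induction n) (auto simp: set_mult_def)

lemma T_image_subgroup: "subgroup (\<phi> ` T n) G"
  by (rule endo.subgroup_img_is_subgroup[OF T_subgroup])

lemma T_Suc_right: "T (Suc n) = \<phi> ` T n <#> F"
  unfolding T_Suc_left using commut_normal[OF T_image_subgroup normal] by simp

lemma T_mono: "m \<le> n \<Longrightarrow> T m \<subseteq> T n"
proof (rule lift_Suc_mono_le[of T])
  fix n
  have "\<one> \<in> (\<phi> ^^ n) ` F"
  proof (induction n)
    case 0
    show ?case using subgroup.one_closed[OF F_subgroup] by simp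
  next
    case (Suc n)
    then have "\<phi> \<one> \<in> \<phi> ` (\<phi> ^^ n) ` F" by (rule imageI)
    then show ?case by (simp add: image_comp)
  qed
  moreover have "x = x \<otimes> \<one>" if "x \<in> T n" for x
    using that T_subset[of n] by auto
  ultimately show "T n \<subseteq> T (Suc n)"
    unfolding trajectory_n.simps set_mult_def by blast
qed

text \<open>The trivial stage \<open>T 0\<close> adds nothing, since it lies in \<open>T 1\<close>.\<close>

lemma T_union_eq: "T_union = (\<Union>n. T n)"
proof
  show "T_union \<subseteq> (\<Union>n. T n)" unfolding trajectory_def by blast
  have "T n \<subseteq> T_union" for n
  proof -
    have "T n \<subseteq> T (Suc n)" "Suc n \<in> {1..}" by (rule T_mono) simp_all
    then show ?thesis unfolding trajectory_def by blast
  qed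
  then show "(\<Union>n. T n) \<subseteq> T_union" by blast
qed

lemma T_union_subgroup: "subgroup T_union G"
proof (rule subgroupI; unfold T_union_eq)
  show "(\<Union>n. T n) \<subseteq> carrier G" using T_subset by blast
  show "(\<Union>n. T n) \<noteq> {}" using subgroup.one_closed[OF T_subgroup] by blast
  show "inv a \<in> (\<Union>n. T n)" if "a \<in> (\<Union>n. T n)" for a
    using that subgroup.m_inv_closed[OF T_subgroup] by blast
  fix a b assume "a \<in> (\<Union>n. T n)" "b \<in> (\<Union>n. T n)"
  then obtain m n where "a \<in> T m" "b \<in> T n" by blast
  then have "a \<in> T (max m n)" "b \<in> T (max m n)"
    using T_mono[of m "max m n"] T_mono[of n "max m n"] by auto
  then have "a \<otimes> b \<in> T (max m n)"
    by (rule subgroup.m_closed[OF T_subgroup])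
  then show "a \<otimes> b \<in> (\<Union>n. T n)" by blast
qed

lemma T_union_image_subgroup: "subgroup (\<phi> ` T_union) G"
  by (rule endo.subgroup_img_is_subgroup[OF T_union_subgroup])

lemma T_union_eq_set_mult: "T_union = \<phi> ` T_union <#> F"
proof -
  have "T_union = (\<Union>n. T (Suc n))"
    unfolding T_union_eq using T_mono[OF le_SucI[OF order_refl]] by blast
  also have "\<dots> = \<phi> ` T_union <#> F"
    unfolding T_Suc_right T_union_eq set_mult_def by blast
  finally show ?thesis .
qed

section \<open>Stabilisation of the index and the growth rate\<close>

text \<open>
  This is the index of \<open>\<phi>(T)\<close> in \<open>T\<close>, counted through coset representatives in \<open>F\<close>; they suffice
  because \<open>T = \<phi>(T) F\<close>, and they make finiteness of the index evident.
\<close>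

definition index :: nat where
  "index = card ((\<lambda>f. \<phi> ` T_union #> f) ` F)"

lemma index_pos: "index > 0"
  using fin subgroup.one_closed[OF F_subgroup] unfolding index_def by (auto simp: card_gt_0_iff)

lemma log_index_eq: "log_index G T_union (\<phi> ` T_union) = ereal (ln (real index))"
proof -
  have "rcosets\<^bsub>G\<lparr>carrier := T_union\<rparr>\<^esub> (\<phi> ` T_union) = (\<lambda>f. \<phi> ` T_union #> f) ` F"
    using rcosets_set_mult_eq_image[OF T_union_image_subgroup F_subset]
      T_union_eq_set_mult by simp
  then show ?thesis using fin unfolding log_index_def index_def by simp
qed

text \<open>
  Lagrange's theorem for \<open>\<phi>(T\<^sub>n)\<close> inside \<open>T\<^sub>n\<^sub>+\<^sub>1\<close>; injectivity of \<open>\<phi>\<close> turns the order of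
  \<open>\<phi>(T\<^sub>n)\<close> back into that of \<open>T\<^sub>n\<close>.
\<close>

lemma card_T_Suc: "card (T (Suc n)) = card ((\<lambda>f. \<phi> ` T n #> f) ` F) * card (T n)"
proof -
  let ?K = "G\<lparr>carrier := T (Suc n)\<rparr>"
  have "\<phi> ` T n \<subseteq> T (Suc n)"
    using subgroup.one_closed[OF F_subgroup] T_subset[of n] endo.hom_closed
    unfolding T_Suc_left set_mult_def by force
  then have "subgroup (\<phi> ` T n) ?K"
    by (rule subgroup_incl[OF T_image_subgroup T_subgroup])
  moreover have "group ?K"
    by (rule subgroup.subgroup_is_group[OF T_subgroup is_group])
  ultimately have "card (rcosets\<^bsub>?K\<^esub> (\<phi> ` T n)) * card (\<phi> ` T n) = card (T (Suc n))"
    using group.lagrange[of ?K] by (simp add: Coset.order_def)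
  moreover have "rcosets\<^bsub>?K\<^esub> (\<phi> ` T n) = (\<lambda>f. \<phi> ` T n #> f) ` F"
    using rcosets_set_mult_eq_image[OF T_image_subgroup F_subset]
    by (simp only: T_Suc_right)
  moreover have "card (\<phi> ` T n) = card (T n)"
    by (rule card_image[OF inj_on_subset[OF inj T_subset]])
  ultimately show ?thesis by simp
qed

text \<open>
  Each of the finitely many elements of \<open>F \<inter> \<phi>(T)\<close> enters at some finite stage and then stays.
\<close>

lemma eventually_Int_stable: "\<exists>N. \<forall>n\<ge>N. F \<inter> \<phi> ` T n = F \<inter> \<phi> ` T_union"
proof -
  have "\<forall>x\<in>F \<inter> \<phi> ` T_union. \<exists>n. x \<in> \<phi> ` T n" by (auto simp: T_union_eq)
  then obtain k where k: "x \<in> \<phi> ` T (k x)" if "x \<in> F \<inter> \<phi> ` T_union" for x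
    by metis
  obtain N where N: "k x \<le> N" if "x \<in> F" for x
    using finite_nat_set_iff_bounded_le[of "k ` F"] fin by auto
  have "F \<inter> \<phi> ` T n = F \<inter> \<phi> ` T_union" if "n \<ge> N" for n
  proof
    show "F \<inter> \<phi> ` T n \<subseteq> F \<inter> \<phi> ` T_union" by (auto simp: T_union_eq)
    show "F \<inter> \<phi> ` T_union \<subseteq> F \<inter> \<phi> ` T n"
    proof
      fix x assume x: "x \<in> F \<inter> \<phi> ` T_union"
      then have "T (k x) \<subseteq> T n" using N[of x] that by (intro T_mono) simp
      then show "x \<in> F \<inter> \<phi> ` T n" using k[OF x] x by blast
    qed
  qed
  then show ?thesis by blast
qed

text \<open>
  From a stage \<open>N\<close> on, \<open>ln |T\<^sub>n|\<close> is affine in \<open>n\<close> with slope \<open>ln index\<close>, and the intercept is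
  lost on division by \<open>n\<close>.
\<close>

lemma H_alg_eq: "H_alg G \<phi> F = ln (real index)"
proof -
  obtain N where N: "F \<inter> \<phi> ` T n = F \<inter> \<phi> ` T_union" if "n \<ge> N" for n
    using eventually_Int_stable by blast
  have step: "card (T (Suc n)) = index * card (T n)" if "n \<ge> N" for n
    unfolding card_T_Suc index_def
    using card_rcosets_eq_if_Int_eq[OF F_subgroup T_image_subgroup
        T_union_image_subgroup N[OF that]] by simp
  have geometric: "card (T (N + k)) = index ^ k * card (T N)" for k
    by (induction k) (simp_all add: step del: trajectory_n.simps)
  have "card (T N) > 0"
    using T_finite subgroup.one_closed[OF T_subgroup] by (auto simp: card_gt_0_iff)
  \<comment> \<open>the intercept at \<open>0\<close> of the affine function that \<open>ln |T\<^sub>n|\<close> equals for \<open>n \<ge> N\<close>\<close>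
  define c where "c = ln (real (card (T N))) - real N * ln (real index)"
  have "ln (real (card (T n))) / real n = ln (real index) + c / real n" if "n \<ge> Suc N" for n
  proof -
    have "card (T n) = index ^ (n - N) * card (T N)"
      using geometric[of "n - N"] that by simp
    then have "ln (real (card (T n))) = real (n - N) * ln (real index) + ln (real (card (T N)))"
      using index_pos \<open>card (T N) > 0\<close> by (simp add: ln_mult ln_realpow)
    then show ?thesis using that by (simp add: c_def of_nat_diff field_simps)
  qed
  then have "\<forall>\<^sub>F n in sequentially.
      ln (real index) + c / real n = ln (real (card (T n))) / real n"
    by (intro eventually_sequentiallyI[of "Suc N"]) simp
  moreover have "(\<lambda>n. ln (real index) + c / real n) \<longlonglongrightarrow> ln (real index) + 0"
    by (intro tendsto_intros lim_const_over_n)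
  ultimately have "(\<lambda>n. ln (real (card (T n))) / real n) \<longlonglongrightarrow> ln (real index)"
    using Lim_transform_eventually by fastforce
  then show ?thesis unfolding H_alg_def by (rule limI)
qed

end

section \<open>The entropy formulas\<close>

theorem H_alg_eq_log_index:
  assumes "group G" "\<phi> \<in> hom G G" "inj_on \<phi> (carrier G)" "finite F" "F \<lhd> G"
  shows "ereal (H_alg G \<phi> F) = log_index G (trajectory G \<phi> F) (\<phi> ` trajectory G \<phi> F)"
proof -
  interpret normal_trajectory G \<phi> F
    using assms by (simp add: normal_trajectory_def normal_trajectory_axioms_def)
  show ?thesis by (simp add: H_alg_eq log_index_eq)
qed

theorem corollary1p1:
  shows "(\<forall>(G :: ('a, 'b) monoid_scheme) \<phi> F.
            locally_finite_group G \<longrightarrow> \<phi> \<in> hom G G \<longrightarrow> inj_on \<phi> (carrier G) \<longrightarrow>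
            finite F \<longrightarrow> F \<lhd> G \<longrightarrow>
            ereal (H_alg G \<phi> F) =
              log_index G (trajectory G \<phi> F) (\<phi> ` trajectory G \<phi> F))
       \<and> (\<forall>(G :: ('c, 'd) monoid_scheme) \<phi>.
            comm_group G \<longrightarrow> torsion_group G \<longrightarrow> \<phi> \<in> hom G G \<longrightarrow> inj_on \<phi> (carrier G) \<longrightarrow>
            h_alg G \<phi> =
              (SUP F\<in>finite_subgroups G.
                 log_index G (trajectory G \<phi> F) (\<phi> ` trajectory G \<phi> F)))"
proof (intro conjI allI impI)
  fix G :: "('a, 'b) monoid_scheme" and \<phi> F
  assume "locally_finite_group G" "\<phi> \<in> hom G G" "inj_on \<phi> (carrier G)" "finite F" "F \<lhd> G"
  then show "ereal (H_alg G \<phi> F) =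
      log_index G (trajectory G \<phi> F) (\<phi> ` trajectory G \<phi> F)"
    by (intro H_alg_eq_log_index) (simp_all add: locally_finite_group_def)
next
  fix G :: "('c, 'd) monoid_scheme" and \<phi>
  assume G: "comm_group G" and \<phi>: "\<phi> \<in> hom G G" "inj_on \<phi> (carrier G)"
  show "h_alg G \<phi> =
      (SUP F\<in>finite_subgroups G. log_index G (trajectory G \<phi> F) (\<phi> ` trajectory G \<phi> F))"
    unfolding h_alg_def
  proof (rule SUP_cong[OF refl])
    fix F assume "F \<in> finite_subgroups G"
    then have "finite F" "F \<lhd> G"
      using comm_group.subgroup_imp_normal[OF G] by (auto simp: finite_subgroups_def)
    then show "ereal (H_alg G \<phi> F) =
        log_index G (trajectory G \<phi> F) (\<phi> ` trajectory G \<phi> F)"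
      using \<phi> comm_group.axioms(2)[OF G] by (intro H_alg_eq_log_index)
  qed
qed

end
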